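(* Let $X_1, X_2, \dots$ be independent and identically distributed real-valued random variables on a probability space, with finite expectation (i.e. $\mathbb{E}[|X_1|]<\infty$), and suppose that $\mathbb{E}[X_1]>0$. Then almost surely $\inf_{n\geq 0}(X_1+\cdots+X_n)$ is finite, i.e. $\inf_{n\geq 0}(X_1+\cdots+X_n)>-\infty$ almost surely.
   Context: For $n=0$ the sum $X_1+\cdots+X_n$ is the empty sum, equal to $0$. *)

theory Defs
  imports "HOL-Probability.Probability"
begin

end

theory Submission
  imports Defs
begin

text \<open>
  Write \<open>S\<^sub>n\<close> for the partial sums of the sequence and \<open>I\<^sub>n = min\<^bsub>k \<le> n\<^esub> S\<^sub>k \<le> 0\<close>. The walk restarted
  after its first step has minima \<open>I'\<^sub>n\<close>, and splitting off the first step gives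
  \<open>I\<^bsub>n+1\<^esub> = min 0 (X\<^sub>1 + I'\<^sub>n)\<close>, that is,
  \<open>I\<^bsub>n+1\<^esub> - I'\<^sub>n = min (- I'\<^sub>n) X\<^sub>1\<close>.
  The minima decrease in \<open>n\<close>, and \<open>I'\<^sub>n\<close> has the law of \<open>I\<^sub>n\<close> because the restarted walk is a copy
  of the original one. Hence \<open>E (min (- I'\<^sub>n) X\<^sub>1) = E I\<^bsub>n+1\<^esub> - E I\<^sub>n \<le> 0\<close> for every \<open>n\<close>.

  Whether the walk is bounded below does not depend on finitely many of its steps, so by
  Kolmogorov's zero-one law the walk is almost surely bounded below or almost surely unbounded
  below. In the second case \<open>I'\<^sub>n\<close> tends to \<open>-\<infinity>\<close> almost surely, so \<open>min (- I'\<^sub>n) X\<^sub>1\<close> is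
  eventually equal to \<open>X\<^sub>1\<close>; it is dominated by \<open>\<bar>X\<^sub>1\<bar>\<close> since \<open>- I'\<^sub>n \<ge> 0\<close>. Dominated convergence
  then yields \<open>E X\<^sub>1 \<le> 0\<close>, contrary to the positive drift.
\<close>

section \<open>Reindexing independent families\<close>

lemma (in prob_space) indep_sets_reindex:
  assumes ind: "indep_sets F (f ` I)" and inj: "inj_on f I"
  shows "indep_sets (\<lambda>i. F (f i)) I"
proof (rule indep_setsI)
  show "F (f i) \<subseteq> events" if "i \<in> I" for i
    using ind that by (auto simp: indep_sets_def)
next
  fix A J assume J: "J \<noteq> {}" "J \<subseteq> I" "finite J" and A: "\<forall>j\<in>J. A j \<in> F (f j)"
  define B where "B = (\<lambda>k. A (the_inv_into J f k))"
  have injJ: "inj_on f J"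
    using inj J(2) by (rule inj_on_subset)
  have B: "B (f j) = A j" if "j \<in> J" for j
    using the_inv_into_f_f[OF injJ that] by (simp add: B_def)
  have "prob (\<Inter>k\<in>f ` J. B k) = (\<Prod>k\<in>f ` J. prob (B k))"
    using J A B by (intro indep_setsD[OF ind]) auto
  then show "prob (\<Inter>j\<in>J. A j) = (\<Prod>j\<in>J. prob (A j))"
    by (simp add: prod.reindex[OF injJ] B image_image)
qed

lemma (in prob_space) indep_vars_reindex:
  assumes "indep_vars N X (f ` I)" and "inj_on f I"
  shows "indep_vars (\<lambda>i. N (f i)) (\<lambda>i. X (f i)) I"
  using assms indep_sets_reindex[of "\<lambda>i. {X i -` A \<inter> space M | A. A \<in> sets (N i)}" f I]
  unfolding indep_vars_def2 by auto

text \<open>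
  Both sides are the product of copies of the common marginal law. For \<open>f = Suc\<close> this says that an
  i.i.d. sequence is stationary.
\<close>

lemma (in prob_space) distr_iid_reindex:
  fixes X :: "'i \<Rightarrow> 'a \<Rightarrow> 'b"
  assumes ind: "indep_vars (\<lambda>_. N) X UNIV"
    and same: "\<And>i j. distr M N (X i) = distr M N (X j)"
    and inj: "inj f"
  shows "distr M (\<Pi>\<^sub>M i\<in>UNIV. N) (\<lambda>\<omega> i. X (f i) \<omega>) = distr M (\<Pi>\<^sub>M i\<in>UNIV. N) (\<lambda>\<omega> i. X i \<omega>)"
proof -
  have rv: "random_variable N (X i)" for i
    using ind by (auto simp: indep_vars_def2)
  have "indep_vars (\<lambda>_. N) X (range f)"
    using ind by (rule indep_vars_subset) simp
  then have "indep_vars (\<lambda>_. N) (\<lambda>i. X (f i)) UNIV"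
    using inj by (rule indep_vars_reindex)
  then have "distr M (\<Pi>\<^sub>M i\<in>UNIV. N) (\<lambda>\<omega>. \<lambda>i\<in>UNIV. X (f i) \<omega>) = (\<Pi>\<^sub>M i\<in>UNIV. distr M N (X (f i)))"
    using rv by (subst (asm) indep_vars_iff_distr_eq_PiM) auto
  also have "\<dots> = (\<Pi>\<^sub>M i\<in>UNIV. distr M N (X i))"
    by (intro PiM_cong refl same)
  also have "\<dots> = distr M (\<Pi>\<^sub>M i\<in>UNIV. N) (\<lambda>\<omega>. \<lambda>i\<in>UNIV. X i \<omega>)"
    using ind rv by (subst (asm) indep_vars_iff_distr_eq_PiM) auto
  finally show ?thesis
    by (simp add: restrict_UNIV)
qed

section \<open>Running minima of partial sums\<close>

text \<open>
  This is the minimum of the partial sums of at most \<open>n\<close> terms. The recursion on the first term,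
  rather than the minimum of a finite set, is the identity that drives the proof.
\<close>

primrec running_min :: "nat \<Rightarrow> (nat \<Rightarrow> real) \<Rightarrow> real" where
  "running_min 0 x = 0"
| "running_min (Suc n) x = min 0 (x 0 + running_min n (\<lambda>i. x (Suc i)))"

lemma running_min_nonpos: "running_min n x \<le> 0"
  by (cases n) auto

lemma running_min_le_sum: "k \<le> n \<Longrightarrow> running_min n x \<le> (\<Sum>i<k. x i)"
proof (induction n arbitrary: k x)
  case (Suc n)
  show ?case
  proof (cases k)
    case 0
    then show ?thesis by simp
  next
    case (Suc k')
    have "running_min n (\<lambda>i. x (Suc i)) \<le> (\<Sum>i<k'. x (Suc i))"
      using Suc.IH Suc.prems Suc by simp
    then show ?thesis
      by (simp add: Suc sum.lessThan_Suc_shift del: sum.lessThan_Suc)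
  qed
qed simp

lemma running_min_Suc_le: "running_min (Suc n) x \<le> running_min n x"
proof (induction n arbitrary: x)
  case (Suc n)
  have "running_min (Suc n) (\<lambda>i. x (Suc i)) \<le> running_min n (\<lambda>i. x (Suc i))"
    by (rule Suc.IH)
  then show ?case
    unfolding running_min.simps(2)[of "Suc n" x] running_min.simps(2)[of n x]
    by (intro min.mono add_left_mono order_refl)
qed simp

lemma running_min_tendsto_at_bot:
  assumes "\<not> bdd_below (range (\<lambda>n. \<Sum>i<n. x i))"
  shows "filterlim (\<lambda>n. running_min n x) at_bot sequentially"
  unfolding filterlim_at_bot
proof
  fix c
  obtain k where "(\<Sum>i<k. x i) \<le> c"
    using assms by (auto simp: bdd_below_def not_le dest: less_imp_le)
  then show "\<forall>\<^sub>F n in sequentially. running_min n x \<le> c"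
    using running_min_le_sum[of k _ x]
    by (auto simp: eventually_sequentially intro!: exI[of _ k] intro: order_trans)
qed

lemma measurable_running_min [measurable]:
  "running_min n \<in> borel_measurable (\<Pi>\<^sub>M i\<in>UNIV. borel)"
proof (induction n)
  case (Suc n)
  have "(\<lambda>x i. x (Suc i)) \<in> measurable (\<Pi>\<^sub>M i\<in>UNIV. borel) (\<Pi>\<^sub>M i\<in>UNIV. borel :: real measure)"
    by (rule measurable_PiM_single') (auto simp: space_PiM)
  from measurable_compose[OF this Suc.IH] show ?case
    by simp
qed simp

lemma integrable_running_min:
  assumes "\<And>i. integrable M (X i)"
  shows "integrable M (\<lambda>\<omega>. running_min n (\<lambda>i. X i \<omega>))"
  using assms
proof (induction n arbitrary: X)
  case (Suc n)
  have "integrable M (\<lambda>\<omega>. running_min n (\<lambda>i. X (Suc i) \<omega>))"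
    by (rule Suc.IH) (rule Suc.prems)
  then show ?case
    using Suc.prems[of 0] by simp
qed simp

section \<open>A zero-one law for the walk\<close>

lemma bdd_below_partial_sums_Suc:
  fixes x :: "nat \<Rightarrow> real"
  shows "bdd_below (range (\<lambda>n. \<Sum>i<n. x (Suc i))) \<longleftrightarrow> bdd_below (range (\<lambda>n. \<Sum>i<n. x i))"
    (is "bdd_below ?S' \<longleftrightarrow> bdd_below ?S")
proof -
  have S: "?S = insert 0 ((+) (x 0) ` ?S')"
  proof -
    have "?S = insert (\<Sum>i<0. x i) (range (\<lambda>n. \<Sum>i<Suc n. x i))"
      by (subst UNIV_nat_eq) (simp add: image_image del: sum.lessThan_Suc)
    then show ?thesis
      by (simp only: sum.lessThan_Suc_shift image_image) simp
  qed
  have "bdd_below ((+) (x 0) ` ?S') \<Longrightarrow> bdd_below ?S'"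
    by (drule bdd_below_image_mono[of "(+) (- x 0)", rotated]) (auto simp: image_image mono_def)
  moreover have "bdd_below ?S' \<Longrightarrow> bdd_below ((+) (x 0) ` ?S')"
    by (rule bdd_below_image_mono) (auto simp: mono_def)
  ultimately show ?thesis
    unfolding S by auto
qed

lemma bdd_below_partial_sums_shift:
  fixes x :: "nat \<Rightarrow> real"
  shows "bdd_below (range (\<lambda>n. \<Sum>i<n. x (i + m))) \<longleftrightarrow> bdd_below (range (\<lambda>n. \<Sum>i<n. x i))"
proof (induction m)
  case (Suc m)
  then show ?case
    using bdd_below_partial_sums_Suc[of "\<lambda>i. x (i + m)"] by simp
qed simp

lemma measurable_bdd_below_range [measurable (raw)]:
  fixes S :: "nat \<Rightarrow> 'a \<Rightarrow> real"
  assumes [measurable]: "\<And>n. S n \<in> borel_measurable N"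
  shows "Measurable.pred N (\<lambda>\<omega>. bdd_below (range (\<lambda>n. S n \<omega>)))"
proof -
  \<comment> \<open>Bounds of the form \<open>- real c\<close> suffice, which leaves only countable quantifiers.\<close>
  have "bdd_below (range s) \<longleftrightarrow> (\<exists>c::nat. \<forall>n. - real c \<le> s n)" for s :: "nat \<Rightarrow> real"
  proof
    assume "bdd_below (range s)"
    then obtain b where b: "b \<le> s n" for n
      by (auto simp: bdd_below_def)
    obtain c :: nat where "- b \<le> real c"
      using real_arch_simple by blast
    then have "- real c \<le> s n" for n
      using b[of n] by linarith
    then show "\<exists>c::nat. \<forall>n. - real c \<le> s n"
      by blast
  qed (auto simp: bdd_below_def)
  then show ?thesis
    by simp
qed

text \<open>
  For each \<open>m\<close>, dropping the first \<open>m\<close> terms does not affect the event, which is therefore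
  measurable with respect to the remaining terms: it is a tail event.
\<close>

lemma (in prob_space) bdd_below_partial_sums_0_1:
  fixes X :: "nat \<Rightarrow> 'a \<Rightarrow> real"
  assumes ind: "indep_vars (\<lambda>_. borel) X UNIV"
  shows "(AE \<omega> in M. bdd_below (range (\<lambda>n. \<Sum>i<n. X i \<omega>))) \<or>
    (AE \<omega> in M. \<not> bdd_below (range (\<lambda>n. \<Sum>i<n. X i \<omega>)))"
proof -
  define F where "F i = sigma_sets (space M) {X i -` B \<inter> space M | B. B \<in> sets borel}" for i
  define A where "A = {\<omega>\<in>space M. bdd_below (range (\<lambda>n. \<Sum>i<n. X i \<omega>))}"
  have [measurable]: "random_variable borel (X i)" for i
    using ind by (auto simp: indep_vars_def2)
  have F_space: "F i \<subseteq> Pow (space M)" for i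
    unfolding F_def by (rule subsetI, rule PowI, erule sigma_sets_into_sp[rotated]) auto
  have "A \<in> tail_events F"
    unfolding tail_events_def
  proof
    fix m
    define N where "N = sigma (space M) (\<Union>(F ` {m..}))"
    have sets_N: "sets N = sigma_sets (space M) (\<Union>(F ` {m..}))" and space_N: "space N = space M"
      using F_space by (auto simp: N_def intro!: sets_measure_of space_measure_of)
    have [measurable]: "X (i + m) \<in> borel_measurable N" for i
    proof (rule measurableI)
      fix B :: "real set" assume "B \<in> sets borel"
      then have "X (i + m) -` B \<inter> space M \<in> F (i + m)"
        by (auto simp: F_def)
      then show "X (i + m) -` B \<inter> space N \<in> sets N"
        unfolding sets_N space_N by (intro sigma_sets.Basic) auto
    qed simp
    have "{\<omega>\<in>space N. bdd_below (range (\<lambda>n. \<Sum>i<n. X (i + m) \<omega>))} \<in> sets N"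
      by measurable
    also have "{\<omega>\<in>space N. bdd_below (range (\<lambda>n. \<Sum>i<n. X (i + m) \<omega>))} = A"
      using bdd_below_partial_sums_shift[of "\<lambda>i. X i _"] by (simp add: A_def space_N)
    finally show "A \<in> sigma_sets (space M) (\<Union>(F ` {m..}))"
      by (simp add: sets_N)
  qed
  moreover have "sigma_algebra (space M) (F i)" for i
    unfolding F_def by (rule sigma_algebra_sigma_sets) auto
  moreover have "indep_sets F UNIV"
    using ind unfolding indep_vars_def F_def by simp
  ultimately have "prob A = 0 \<or> prob A = 1"
    by (intro kolmogorov_0_1_law)
  moreover have "A \<in> events"
    unfolding A_def by measurable
  ultimately show ?thesis
    by (auto simp: prob_eq_0 prob_eq_1 A_def)
qed

section \<open>Walks with positive drift\<close>

text \<open>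
  The left-hand side is \<open>E I\<^bsub>n+1\<^esub> - E I'\<^sub>n\<close>, where \<open>I\<close> and \<open>I'\<close> are the running minima of the walk and
  of the walk restarted after one step; stationarity turns \<open>E I'\<^sub>n\<close> into \<open>E I\<^sub>n\<close>,
  and \<open>I\<^bsub>n+1\<^esub> \<le> I\<^sub>n\<close>.
\<close>

lemma (in prob_space) expectation_min_running_min_le_0:
  fixes X :: "nat \<Rightarrow> 'a \<Rightarrow> real"
  assumes ind: "indep_vars (\<lambda>_. borel) X UNIV"
    and same: "\<And>i j. distr M borel (X i) = distr M borel (X j)"
    and int: "\<And>i. integrable M (X i)"
  shows "expectation (\<lambda>\<omega>. min (- running_min n (\<lambda>i. X (Suc i) \<omega>)) (X 0 \<omega>)) \<le> 0"
proof -
  have rv: "random_variable borel (X i)" for i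
    using ind by (auto simp: indep_vars_def2)
  have seq: "(\<lambda>\<omega> i. X (f i) \<omega>) \<in> measurable M (\<Pi>\<^sub>M i\<in>UNIV. borel)" for f :: "nat \<Rightarrow> nat"
    by (rule measurable_PiM_single') (auto simp: rv)
  have "expectation (\<lambda>\<omega>. running_min n (\<lambda>i. X (Suc i) \<omega>))
      = integral\<^sup>L (distr M (\<Pi>\<^sub>M i\<in>UNIV. borel) (\<lambda>\<omega> i. X (Suc i) \<omega>)) (running_min n)"
    by (rule integral_distr[symmetric, OF seq measurable_running_min])
  also have "\<dots> = integral\<^sup>L (distr M (\<Pi>\<^sub>M i\<in>UNIV. borel) (\<lambda>\<omega> i. X i \<omega>)) (running_min n)"
    by (simp add: distr_iid_reindex[OF ind same inj_Suc])
  also have "\<dots> = expectation (\<lambda>\<omega>. running_min n (\<lambda>i. X i \<omega>))"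
    by (rule integral_distr[OF seq[of "\<lambda>i. i"] measurable_running_min])
  finally have stationary: "expectation (\<lambda>\<omega>. running_min n (\<lambda>i. X (Suc i) \<omega>))
      = expectation (\<lambda>\<omega>. running_min n (\<lambda>i. X i \<omega>))" .
  have "min (- running_min n (\<lambda>i. X (Suc i) \<omega>)) (X 0 \<omega>)
      = running_min (Suc n) (\<lambda>i. X i \<omega>) - running_min n (\<lambda>i. X (Suc i) \<omega>)" for \<omega>
    by (simp add: min_def)
  then have "expectation (\<lambda>\<omega>. min (- running_min n (\<lambda>i. X (Suc i) \<omega>)) (X 0 \<omega>))
      = expectation (\<lambda>\<omega>. running_min (Suc n) (\<lambda>i. X i \<omega>))
        - expectation (\<lambda>\<omega>. running_min n (\<lambda>i. X (Suc i) \<omega>))"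
    by (simp only:) (intro Bochner_Integration.integral_diff integrable_running_min int)
  also have "\<dots> \<le> 0"
    unfolding stationary diff_le_0_iff_le
    by (intro integral_mono integrable_running_min int running_min_Suc_le)
  finally show ?thesis .
qed

lemma (in prob_space) AE_bdd_below_partial_sums:
  fixes X :: "nat \<Rightarrow> 'a \<Rightarrow> real"
  assumes ind: "indep_vars (\<lambda>_. borel) X UNIV"
    and same: "\<And>i j. distr M borel (X i) = distr M borel (X j)"
    and int: "\<And>i. integrable M (X i)"
    and drift: "expectation (X 0) > 0"
  shows "AE \<omega> in M. bdd_below (range (\<lambda>n. \<Sum>i<n. X i \<omega>))"
proof (rule ccontr)
  let ?g = "\<lambda>n \<omega>. min (- running_min n (\<lambda>i. X (Suc i) \<omega>)) (X 0 \<omega>)"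
  assume "\<not> ?thesis"
  then have "AE \<omega> in M. \<not> bdd_below (range (\<lambda>n. \<Sum>i<n. X i \<omega>))"
    using bdd_below_partial_sums_0_1[OF ind] by blast
  then have lim: "AE \<omega> in M. (\<lambda>n. ?g n \<omega>) \<longlonglongrightarrow> X 0 \<omega>"
  proof eventually_elim
    case (elim \<omega>)
    then have "filterlim (\<lambda>n. running_min n (\<lambda>i. X (Suc i) \<omega>)) at_bot sequentially"
      using bdd_below_partial_sums_Suc[of "\<lambda>i. X i \<omega>"] by (intro running_min_tendsto_at_bot) simp
    then have "\<forall>\<^sub>F n in sequentially. running_min n (\<lambda>i. X (Suc i) \<omega>) \<le> - X 0 \<omega>"
      by (simp add: filterlim_at_bot)
    then have "\<forall>\<^sub>F n in sequentially. ?g n \<omega> = X 0 \<omega>"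
      by eventually_elim simp
    then show ?case
      by (rule tendsto_eventually)
  qed
  have "(\<lambda>n. expectation (?g n)) \<longlonglongrightarrow> expectation (X 0)"
  proof (rule integral_dominated_convergence[OF _ _ _ lim])
    show "integrable M (\<lambda>\<omega>. \<bar>X 0 \<omega>\<bar>)"
      using int by simp
    show "AE \<omega> in M. norm (?g n \<omega>) \<le> \<bar>X 0 \<omega>\<bar>" for n
    proof (rule AE_I2)
      fix \<omega>
      show "norm (?g n \<omega>) \<le> \<bar>X 0 \<omega>\<bar>"
        using running_min_nonpos[of n "\<lambda>i. X (Suc i) \<omega>"] by (auto simp: min_def)
    qed
    show "?g n \<in> borel_measurable M" for n
      using integrable_running_min[of M "\<lambda>i. X (Suc i)" n] int
      by (intro borel_measurable_min borel_measurable_uminus borel_measurable_integrable) auto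
  qed (use int in auto)
  then have "expectation (X 0) \<le> 0"
    by (rule LIMSEQ_le_const2) (use expectation_min_running_min_le_0[OF ind same int] in blast)
  with drift show False
    by simp
qed

theorem lemma1:
  fixes M :: "'a measure" and X :: "nat \<Rightarrow> 'a \<Rightarrow> real"
  assumes "prob_space M"
    and "prob_space.indep_vars M (\<lambda>_. borel) X {1..}"
    and "\<And>i. i \<ge> 1 \<Longrightarrow> distr M borel (X i) = distr M borel (X 1)"
    and "integrable M (X 1)"
    and "prob_space.expectation M (X 1) > 0"
  shows "AE \<omega> in M. (INF n::nat. ereal (\<Sum>i=1..n. X i \<omega>)) > -\<infinity>"
proof -
  interpret prob_space M
    by (rule assms(1))
  have rv: "random_variable borel (X (Suc i))" for i
    using assms(2) by (auto simp: indep_vars_def2)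
  have "range Suc = {1..}"
    unfolding greaterThan_0[symmetric] by auto
  then have ind: "indep_vars (\<lambda>_. borel) (\<lambda>i. X (Suc i)) UNIV"
    using assms(2) indep_vars_reindex[of "\<lambda>_. borel" X Suc UNIV] by simp
  have same: "distr M borel (X (Suc i)) = distr M borel (X 1)" for i
    by (rule assms(3)) simp
  have integrable_iff: "integrable (distr M borel (X (Suc i))) (\<lambda>x. x) \<longleftrightarrow> integrable M (X (Suc i))" for i
    by (rule integrable_distr_eq[OF rv]) simp
  have int: "integrable M (X (Suc i))" for i
    using assms(4) integrable_iff[of i] integrable_iff[of 0] same[of i] by simp
  have "AE \<omega> in M. bdd_below (range (\<lambda>n. \<Sum>i<n. X (Suc i) \<omega>))"
  proof (rule AE_bdd_below_partial_sums[OF ind])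
    show "distr M borel (X (Suc i)) = distr M borel (X (Suc j))" for i j
      by (simp only: same)
  qed (use int assms(5) in simp_all)
  then show ?thesis
  proof eventually_elim
    case (elim \<omega>)
    then obtain c where c: "c \<le> (\<Sum>i<n. X (Suc i) \<omega>)" for n
      by (auto simp: bdd_below_def)
    then have "ereal c \<le> (INF n::nat. ereal (\<Sum>i=1..n. X i \<omega>))"
      by (intro INF_greatest) (simp add: sum.atLeast1_atMost_eq)
    then show ?case
      by (rule less_le_trans[rotated]) simp
  qed
qed

end
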